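(* Let $a,b,c,c_1,c_2\in\mathbb{R}$ with $ac_1+bc_2\neq0$ and $b\neq0$, and let $K(s)$ be a continuous function on an interval containing $s_0$. There exists a 2-parameter family of parabolic revolution surfaces of i-type in $\mathbb{I}^3$ with $K$ as the Gaussian curvature (i.e. the Gaussian curvature at the point with parameters $(s,t)$ is $K(s)$) and whose generating curves $\alpha_{k_0,k_1}(s)=(s,0,z(s))$, $s$ arc-length parameter, satisfy $$z(s)=k_0+k_1s+\frac{c_1^2\,s^2}{2(ac_1+bc_2)}+\frac{b^2}{ac_1+bc_2}\int_{s_0}^{s}\int_{s_0}^{v}K(w)\,dw\,dv,$$ where $k_0,k_1$ are constants depending on the values of $z,z'$ at $s=s_0$.
   Context: The simply isotropic space $\mathbb{I}^3$ is $\mathbb{R}^3$ with the degenerate metric $\langle u,v\rangle_z=u^1v^1+u^2v^2$. For a $C^2$ parameterized surface $\mathbf{x}(u^1,u^2)=(x^1,x^2,x^3)$ write $\mathbf{x}_i=\partial\mathbf{x}/\partial u^i$, $\mathbf{x}_{ij}=\partial^2\mathbf{x}/\partial u^i\partial u^j$, $x^i_k=\partial x^i/\partial u^k$, $X_{ij}=x^i_1x^j_2-x^j_1x^i_2$. The surface is admissible if $X_{12}\neq0$ (equivalently, the induced metric has rank 2). Put $g_{ij}=\langle\mathbf{x}_i,\mathbf{x}_j\rangle_z$, $N_h=\left(\frac{X_{23}}{X_{12}},\frac{X_{31}}{X_{12}},1\right)$, $h_{ij}=\langle N_h,\mathbf{x}_{ij}\rangle$ (Euclidean inner product). The Gaussian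 and mean curvatures are $$K=\frac{h_{11}h_{22}-h_{12}^2}{g_{11}g_{22}-g_{12}^2},\qquad H=\frac12\,\frac{g_{11}h_{22}-2g_{12}h_{12}+g_{22}h_{11}}{g_{11}g_{22}-g_{12}^2};$$ equivalently $K=\det L$, $H=\frac12\mathrm{tr}\,L$ with $L=-D\xi$, $\xi=\left(A,B,\frac12(1-A^2-B^2)\right)$, $A=X_{23}/X_{12}$, $B=X_{31}/X_{12}$. The parabolic revolution surface of i-type with generating curve $\alpha(u)=(x(u),0,z(u))$ (a $C^2$ curve) and parameters $a,b,c,c_1,c_2$, where $ac_1+bc_2\neq0$, is $$Z_3(u,t)=\left(at+x(u),\ bt,\ ct+\tfrac{ac_1+bc_2}{2}t^2+c_1t\,x(u)+z(u)\right),$$ with coordinates $(u^1,u^2)=(u,t)$. It is admissible when $b\,x'\neq0$; surfaces are assumed admissible. *)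

theory Defs
  imports "HOL-Analysis.Analysis"
begin

section \<open>Curves and surfaces of class \<open>C\<^sup>2\<close>\<close>

text \<open>Derivatives are taken within the parameter domain, so they are one-sided at those boundary
  points that belong to it. The domains used below are nondegenerate in each coordinate direction,
  which makes these derivatives unique.\<close>

definition curve_deriv :: "real set \<Rightarrow> (real \<Rightarrow> real ^ 3) \<Rightarrow> real \<Rightarrow> real ^ 3" where
  "curve_deriv I \<alpha> s = vector_derivative \<alpha> (at s within I)"

definition C2_curve_on :: "real set \<Rightarrow> (real \<Rightarrow> real ^ 3) \<Rightarrow> bool" where
  "C2_curve_on I \<alpha> \<longleftrightarrow>
     \<alpha> differentiable_on I \<and>
     curve_deriv I \<alpha> differentiable_on I \<and>
     continuous_on I (curve_deriv I (curve_deriv I \<alpha>))"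

definition partial_line :: "(real ^ 2) set \<Rightarrow> 2 \<Rightarrow> real ^ 2 \<Rightarrow> real set" where
  "partial_line D i u = {r. u + r *\<^sub>R axis i 1 \<in> D}"

definition partial_exists :: "(real ^ 2) set \<Rightarrow> (real ^ 2 \<Rightarrow> real ^ 3) \<Rightarrow> 2 \<Rightarrow> real ^ 2 \<Rightarrow> bool" where
  "partial_exists D f i u \<longleftrightarrow>
     (\<lambda>r. f (u + r *\<^sub>R axis i 1)) differentiable (at 0 within partial_line D i u)"

definition partial :: "(real ^ 2) set \<Rightarrow> (real ^ 2 \<Rightarrow> real ^ 3) \<Rightarrow> 2 \<Rightarrow> real ^ 2 \<Rightarrow> real ^ 3" where
  "partial D f i u =
     vector_derivative (\<lambda>r. f (u + r *\<^sub>R axis i 1)) (at 0 within partial_line D i u)"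

definition C1_surface_on :: "(real ^ 2) set \<Rightarrow> (real ^ 2 \<Rightarrow> real ^ 3) \<Rightarrow> bool" where
  "C1_surface_on D f \<longleftrightarrow>
     (\<forall>i. (\<forall>u\<in>D. partial_exists D f i u) \<and> continuous_on D (partial D f i))"

definition C2_surface_on :: "(real ^ 2) set \<Rightarrow> (real ^ 2 \<Rightarrow> real ^ 3) \<Rightarrow> bool" where
  "C2_surface_on D f \<longleftrightarrow> C1_surface_on D f \<and> (\<forall>i. C1_surface_on D (partial D f i))"


section \<open>Simply isotropic geometry\<close>

definition iso_inner :: "real ^ 3 \<Rightarrow> real ^ 3 \<Rightarrow> real" where
  "iso_inner v w = v $ 1 * w $ 1 + v $ 2 * w $ 2"

definition arc_length_param_on :: "real set \<Rightarrow> (real \<Rightarrow> real ^ 3) \<Rightarrow> bool" where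
  "arc_length_param_on I \<alpha> \<longleftrightarrow>
     (\<forall>s\<in>I. sqrt (iso_inner (curve_deriv I \<alpha> s) (curve_deriv I \<alpha> s)) = 1)"

definition Xminor ::
  "(real ^ 2) set \<Rightarrow> (real ^ 2 \<Rightarrow> real ^ 3) \<Rightarrow> 3 \<Rightarrow> 3 \<Rightarrow> real ^ 2 \<Rightarrow> real" where
  "Xminor D f i j u =
     partial D f 1 u $ i * partial D f 2 u $ j - partial D f 1 u $ j * partial D f 2 u $ i"

definition admissible_on :: "(real ^ 2) set \<Rightarrow> (real ^ 2 \<Rightarrow> real ^ 3) \<Rightarrow> bool" where
  "admissible_on D f \<longleftrightarrow> C2_surface_on D f \<and> (\<forall>u\<in>D. Xminor D f 1 2 u \<noteq> 0)"

definition first_form ::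
  "(real ^ 2) set \<Rightarrow> (real ^ 2 \<Rightarrow> real ^ 3) \<Rightarrow> 2 \<Rightarrow> 2 \<Rightarrow> real ^ 2 \<Rightarrow> real" where
  "first_form D f i j u = iso_inner (partial D f i u) (partial D f j u)"

definition normal_h :: "(real ^ 2) set \<Rightarrow> (real ^ 2 \<Rightarrow> real ^ 3) \<Rightarrow> real ^ 2 \<Rightarrow> real ^ 3" where
  "normal_h D f u =
     vector [Xminor D f 2 3 u / Xminor D f 1 2 u, Xminor D f 3 1 u / Xminor D f 1 2 u, 1]"

definition second_form ::
  "(real ^ 2) set \<Rightarrow> (real ^ 2 \<Rightarrow> real ^ 3) \<Rightarrow> 2 \<Rightarrow> 2 \<Rightarrow> real ^ 2 \<Rightarrow> real" where
  "second_form D f i j u = normal_h D f u \<bullet> partial D (partial D f i) j u"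

definition gauss_curvature :: "(real ^ 2) set \<Rightarrow> (real ^ 2 \<Rightarrow> real ^ 3) \<Rightarrow> real ^ 2 \<Rightarrow> real" where
  "gauss_curvature D f u =
     (second_form D f 1 1 u * second_form D f 2 2 u - (second_form D f 1 2 u)\<^sup>2) /
     (first_form D f 1 1 u * first_form D f 2 2 u - (first_form D f 1 2 u)\<^sup>2)"


section \<open>Parabolic revolution surfaces of i-type\<close>

definition generating_curve :: "(real \<Rightarrow> real) \<Rightarrow> (real \<Rightarrow> real) \<Rightarrow> real \<Rightarrow> real ^ 3" where
  "generating_curve x z u = vector [x u, 0, z u]"

definition parabolic_revolution_surface ::
  "real \<Rightarrow> real \<Rightarrow> real \<Rightarrow> real \<Rightarrow> real \<Rightarrow> (real \<Rightarrow> real) \<Rightarrow> (real \<Rightarrow> real) \<Rightarrow> real ^ 2 \<Rightarrow> real ^ 3" where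
  "parabolic_revolution_surface a b c c1 c2 x z p =
     (let u = p $ 1; t = p $ 2 in
      vector [a * t + x u,
              b * t,
              c * t + (a * c1 + b * c2) / 2 * t\<^sup>2 + c1 * t * x u + z u])"

definition param_strip :: "real set \<Rightarrow> (real ^ 2) set" where
  "param_strip I = {p. p $ 1 \<in> I}"

end

theory Submission
  imports Defs
begin

text \<open>
  Put \<open>m = a * c1 + b * c2\<close>. When the generating curve is the graph of \<open>z\<close>, the
  surface has the coordinate fields \<open>x\<^sub>1 = (1, 0, c1 t + z')\<close> and
  \<open>x\<^sub>2 = (a, b, c + m t + c1 s)\<close>, so all second derivatives are vertical:
  \<open>x\<^sub>1\<^sub>1 = (0, 0, z'')\<close>, \<open>x\<^sub>1\<^sub>2 = (0, 0, c1)\<close> and \<open>x\<^sub>2\<^sub>2 = (0, 0, m)\<close>. The normal has third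
  component 1, so these third components are the second fundamental form. The metric is constant
  in \<open>s\<close> and \<open>t\<close>, with determinant \<open>b\<^sup>2\<close>. Hence
  \<open>K = (m z'' - c1\<^sup>2) / b\<^sup>2\<close> (\<open>gauss_curvature_parabolic_revolution\<close>), an expression that does
  not involve \<open>t\<close>, and prescribing \<open>K\<close> amounts to the linear equation
  \<open>z'' = c1\<^sup>2 / m + (b\<^sup>2 / m) K\<close>.

  Integrating this equation twice from \<open>s0\<close> gives the profile. The double integral and its
  derivative vanish at \<open>s0\<close>, so there \<open>(z, z')\<close> is an invertible affine function of
  \<open>(k0, k1)\<close>; this is why the two constants parameterize the initial data.

  The interval may contain some of its endpoints, and \<open>K\<close> is only known to be continuous on it.
  All derivatives are therefore taken within the interval, which determines them because every
  point of a nondegenerate interval is a limit point of it.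
\<close>

section \<open>Derivatives on intervals\<close>

lemma interval_at_within_neq_bot:
  fixes I :: "real set"
  assumes "is_interval I" "\<And>x. I \<noteq> {x}" "s \<in> I"
  shows "at s within I \<noteq> bot"
  using connected_imp_perfect[of I s] assms
  by (simp add: is_interval_connected trivial_limit_within)

text \<open>The library version of this form of the fundamental theorem is for a compact interval. Near
  one of its points an arbitrary interval agrees with a compact subinterval that contains the base
  point: on each side, the point is either an endpoint of the interval or is followed by a further
  point of it.\<close>

lemma interval_integral_has_vector_derivative_within:
  fixes f :: "real \<Rightarrow> 'a::euclidean_space"
  assumes I: "is_interval I" and "c \<in> I" "x \<in> I" and cont: "continuous_on I f"
  shows "((\<lambda>u. LBINT y=c..u. f y) has_vector_derivative f x) (at x within I)"
proof -
  have mem: "y \<in> I" if "p \<in> I" "q \<in> I" "p \<le> y" "y \<le> q" for p q y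
    using I that unfolding is_interval_1 by blast
  \<comment> \<open>Right of \<open>l\<close> the interval has no points below \<open>p\<close>, so cutting it at \<open>p\<close> does not
    change it near \<open>x\<close>; \<open>h\<close> and \<open>q\<close> play the same part above \<open>x\<close>.\<close>
  obtain p l where p: "p \<in> I" "p \<le> c" "p \<le> x" "l < x" "\<And>y. y \<in> I \<Longrightarrow> l < y \<Longrightarrow> p \<le> y"
  proof (cases "\<exists>q\<in>I. q < x")
    case True
    then obtain q where "q \<in> I" "q < x" by blast
    with \<open>c \<in> I\<close> show ?thesis by (intro that[of "min q c" "min q c"]) (auto simp: min_def)
  next
    case False
    with \<open>c \<in> I\<close> \<open>x \<in> I\<close> show ?thesis by (intro that[of x "x - 1"]) (auto simp: not_less)
  qed
  obtain q h where q: "q \<in> I" "c \<le> q" "x \<le> q" "x < h" "\<And>y. y \<in> I \<Longrightarrow> y < h \<Longrightarrow> y \<le> q"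
  proof (cases "\<exists>q\<in>I. x < q")
    case True
    then obtain q where "q \<in> I" "x < q" by blast
    with \<open>c \<in> I\<close> show ?thesis by (intro that[of "max q c" "max q c"]) (auto simp: max_def)
  next
    case False
    with \<open>c \<in> I\<close> \<open>x \<in> I\<close> show ?thesis by (intro that[of x "x + 1"]) (auto simp: not_less)
  qed
  have sub: "{p..q} \<subseteq> I"
    using mem[OF p(1) q(1)] by auto
  have "((\<lambda>u. LBINT y=c..u. f y) has_vector_derivative f x) (at x within {p..q})"
    using p q by (intro interval_integral_FTC2 continuous_on_subset[OF cont sub]) auto
  moreover have "at x within {p..q} = at x within I"
    using p q sub by (intro at_within_nhd[where S = "{l<..<h}"]) auto
  ultimately show ?thesis
    by simp
qed

lemma vector_3_eq_axes:
  "(vector [x, y, z] :: real ^ 3) = x *\<^sub>R axis 1 1 + y *\<^sub>R axis 2 1 + z *\<^sub>R axis 3 1"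
  by (simp add: vec_eq_iff forall_3 axis_def)

lemma has_vector_derivative_vector_3:
  assumes "(f has_real_derivative f') (at x within S)"
    and "(g has_real_derivative g') (at x within S)"
    and "(h has_real_derivative h') (at x within S)"
  shows "((\<lambda>r. vector [f r, g r, h r] :: real ^ 3) has_vector_derivative vector [f', g', h'])
    (at x within S)"
  unfolding vector_3_eq_axes using assms
  by (auto intro!: derivative_eq_intros)

lemma continuous_on_vector_3:
  fixes f g h :: "'a::topological_space \<Rightarrow> real"
  assumes "continuous_on S f" "continuous_on S g" "continuous_on S h"
  shows "continuous_on S (\<lambda>p. vector [f p, g p, h p] :: real ^ 3)"
  unfolding vector_3_eq_axes using assms by (intro continuous_intros)

section \<open>Partial derivatives on a parameter strip\<close>

lemma has_vector_derivative_translate: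
  fixes F :: "real \<Rightarrow> 'a::real_normed_vector"
  assumes "(F has_vector_derivative d) (at s within S)"
  shows "((\<lambda>r. F (s + r)) has_vector_derivative d) (at 0 within {r. s + r \<in> S})"
proof -
  have "(\<lambda>r. s + r) ` {r. s + r \<in> S} = S"
    by (auto simp: image_iff) (metis diff_add_cancel add.commute)
  then have "((F \<circ> (\<lambda>r. s + r)) has_vector_derivative 1 *\<^sub>R d) (at 0 within {r. s + r \<in> S})"
    using assms by (intro vector_diff_chain_within) (auto intro!: derivative_eq_intros)
  then show ?thesis
    by (simp add: o_def)
qed

lemma partial_eqI:
  assumes u: "u \<in> D" and nontriv: "at 0 within partial_line D i u \<noteq> bot"
    and f: "\<And>r. r \<in> partial_line D i u \<Longrightarrow> f (u + r *\<^sub>R axis i 1) = g r"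
    and g: "(g has_vector_derivative d) (at 0 within partial_line D i u)"
  shows "partial_exists D f i u" "partial D f i u = d"
proof -
  have "0 \<in> partial_line D i u"
    using u by (simp add: partial_line_def)
  then have "((\<lambda>r. f (u + r *\<^sub>R axis i 1)) has_vector_derivative d) (at 0 within partial_line D i u)"
    using f g by (rule has_vector_derivative_transform)
  with nontriv show "partial_exists D f i u" "partial D f i u = d"
    unfolding partial_exists_def partial_def
    by (auto intro: vector_derivative_within differentiableI_vector)
qed

text \<open>Agreement of \<open>f\<close> with \<open>F\<close> is only asked for on the strip, so that the rule can be
  iterated: a partial derivative of \<open>f\<close> has a known value only there.\<close>

lemma strip_partial:
  fixes F :: "real \<Rightarrow> real \<Rightarrow> real ^ 3"
  assumes I: "is_interval I" "\<And>x. I \<noteq> {x}"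
    and f: "\<And>p. p \<in> param_strip I \<Longrightarrow> f p = F (p $ 1) (p $ 2)"
    and u: "u \<in> param_strip I"
  shows "((\<lambda>s. F s (u $ 2)) has_vector_derivative d) (at (u $ 1) within I) \<Longrightarrow>
      partial_exists (param_strip I) f 1 u \<and> partial (param_strip I) f 1 u = d"
    and "(F (u $ 1) has_vector_derivative d) (at (u $ 2)) \<Longrightarrow>
      partial_exists (param_strip I) f 2 u \<and> partial (param_strip I) f 2 u = d"
proof -
  have u1: "u $ 1 \<in> I"
    using u by (simp add: param_strip_def)
  have line1: "partial_line (param_strip I) 1 u = {r. u $ 1 + r \<in> I}"
    by (simp add: partial_line_def param_strip_def axis_def)
  have line2: "partial_line (param_strip I) 2 u = UNIV"
    using u1 by (simp add: partial_line_def param_strip_def axis_def)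
  have image: "{r. u $ 1 + r \<in> I} = (+) (- (u $ 1)) ` I"
    by (force simp: image_iff)
  have nontriv1: "at 0 within {r. u $ 1 + r \<in> I} \<noteq> bot"
  proof (rule interval_at_within_neq_bot)
    show "is_interval {r. u $ 1 + r \<in> I}"
      using I(1) unfolding image by simp
    show "0 \<in> {r. u $ 1 + r \<in> I}"
      using u1 by simp
    fix x
    obtain y where "y \<in> I" "y \<noteq> u $ 1 + x"
      using I(2)[of "u $ 1 + x"] subset_singletonD[of I "u $ 1 + x"] u1 by blast
    then have "y - u $ 1 \<in> {r. u $ 1 + r \<in> I}" "y - u $ 1 \<noteq> x"
      by auto
    then show "{r. u $ 1 + r \<in> I} \<noteq> {x}"
      by blast
  qed
  have f1: "f (u + r *\<^sub>R axis 1 1) = F (u $ 1 + r) (u $ 2)" if "u $ 1 + r \<in> I" for r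
    using that f[of "u + r *\<^sub>R axis 1 1"] by (simp add: param_strip_def axis_def)
  have f2: "f (u + r *\<^sub>R axis 2 1) = F (u $ 1) (u $ 2 + r)" for r
    using u1 f[of "u + r *\<^sub>R axis 2 1"] by (simp add: param_strip_def axis_def)
  show "partial_exists (param_strip I) f 1 u \<and> partial (param_strip I) f 1 u = d"
    if "((\<lambda>s. F s (u $ 2)) has_vector_derivative d) (at (u $ 1) within I)"
    using partial_eqI[OF u, of 1 f "\<lambda>r. F (u $ 1 + r) (u $ 2)" d, unfolded line1]
      has_vector_derivative_translate[OF that] nontriv1 f1
    by simp
  show "partial_exists (param_strip I) f 2 u \<and> partial (param_strip I) f 2 u = d"
    if "(F (u $ 1) has_vector_derivative d) (at (u $ 2))"
    using partial_eqI[OF u, of 2 f "\<lambda>r. F (u $ 1) (u $ 2 + r)" d, unfolded line2]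
      has_vector_derivative_translate[OF that] f2
    by simp
qed

lemma C1_surface_on_strip:
  fixes F Fs Ft :: "real \<Rightarrow> real \<Rightarrow> real ^ 3"
  assumes I: "is_interval I" "\<And>x. I \<noteq> {x}"
    and f: "\<And>p. p \<in> param_strip I \<Longrightarrow> f p = F (p $ 1) (p $ 2)"
    and Fs: "\<And>s t. s \<in> I \<Longrightarrow> ((\<lambda>s. F s t) has_vector_derivative Fs s t) (at s within I)"
    and Ft: "\<And>s t. s \<in> I \<Longrightarrow> (F s has_vector_derivative Ft s t) (at t)"
    and cont: "continuous_on (param_strip I) (\<lambda>p. Fs (p $ 1) (p $ 2))"
      "continuous_on (param_strip I) (\<lambda>p. Ft (p $ 1) (p $ 2))"
  shows "C1_surface_on (param_strip I) f \<and>
    (\<forall>u\<in>param_strip I. partial (param_strip I) f 1 u = Fs (u $ 1) (u $ 2) \<and>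
      partial (param_strip I) f 2 u = Ft (u $ 1) (u $ 2))"
proof -
  have p1: "partial_exists (param_strip I) f 1 u \<and>
      partial (param_strip I) f 1 u = Fs (u $ 1) (u $ 2)" if "u \<in> param_strip I" for u
    using that by (intro strip_partial[where F = F, OF I f] Fs) (auto simp: param_strip_def)
  have p2: "partial_exists (param_strip I) f 2 u \<and>
      partial (param_strip I) f 2 u = Ft (u $ 1) (u $ 2)" if "u \<in> param_strip I" for u
    using that by (intro strip_partial[where F = F, OF I f] Ft) (auto simp: param_strip_def)
  have "continuous_on (param_strip I) (partial (param_strip I) f 1)"
    using cont(1) p1 by (simp cong: continuous_on_cong)
  moreover have "continuous_on (param_strip I) (partial (param_strip I) f 2)"
    using cont(2) p2 by (simp cong: continuous_on_cong)
  ultimately show ?thesis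
    using p1 p2 by (simp add: C1_surface_on_def forall_2)
qed

lemma continuous_on_strip_first:
  assumes "continuous_on I g"
  shows "continuous_on (param_strip I) (\<lambda>p. g (p $ 1))"
  by (rule continuous_on_compose2[OF assms, where f = "\<lambda>p. p $ 1"])
    (auto simp: param_strip_def intro!: continuous_on_component)

section \<open>Curvature of parabolic revolution surfaces\<close>

text \<open>Admissibility comes from \<open>b \<noteq> 0\<close>, since the minor \<open>X\<^sub>1\<^sub>2\<close> is the constant \<open>b\<close>. The
  horizontal components of the normal do not enter the curvature, because its inner products are
  with vertical vectors only.\<close>

lemma gauss_curvature_parabolic_revolution:
  fixes z z' z'' :: "real \<Rightarrow> real" and a b c c1 c2 :: real
  defines "S \<equiv> parabolic_revolution_surface a b c c1 c2 (\<lambda>s. s) z"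
  assumes I: "is_interval I" "\<And>x. I \<noteq> {x}" and b: "b \<noteq> 0"
    and z': "\<And>s. s \<in> I \<Longrightarrow> (z has_real_derivative z' s) (at s within I)"
    and z'': "\<And>s. s \<in> I \<Longrightarrow> (z' has_real_derivative z'' s) (at s within I)"
    and cont: "continuous_on I z''"
  shows "admissible_on (param_strip I) S"
    and "\<And>u. u \<in> param_strip I \<Longrightarrow> gauss_curvature (param_strip I) S u =
      ((a * c1 + b * c2) * z'' (u $ 1) - c1\<^sup>2) / b\<^sup>2"
proof -
  let ?D = "param_strip I" and ?m = "a * c1 + b * c2"
  have "continuous_on I z'"
    using z'' by (rule DERIV_continuous_on)
  note cont_z = continuous_on_strip_first[OF this] continuous_on_strip_first[OF cont]
  have surf: "S p = vector [a * p $ 2 + p $ 1, b * p $ 2,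
      c * p $ 2 + ?m / 2 * (p $ 2)\<^sup>2 + c1 * p $ 2 * p $ 1 + z (p $ 1)]" for p
    by (simp add: S_def parabolic_revolution_surface_def Let_def)
  have "C1_surface_on ?D S \<and>
    (\<forall>u\<in>?D. partial ?D S 1 u = vector [1, 0, c1 * u $ 2 + z' (u $ 1)] \<and>
      partial ?D S 2 u = vector [a, b, c + ?m * u $ 2 + c1 * u $ 1])"
    by (rule C1_surface_on_strip[where F = "\<lambda>s t. vector [a * t + s, b * t,
          c * t + ?m / 2 * t\<^sup>2 + c1 * t * s + z s]", OF I surf];
        intro has_vector_derivative_vector_3 continuous_on_vector_3 continuous_intros cont_z)
      (auto intro!: derivative_eq_intros z')
  then have first: "C1_surface_on ?D S"
    and x1: "\<And>u. u \<in> ?D \<Longrightarrow> partial ?D S 1 u = vector [1, 0, c1 * u $ 2 + z' (u $ 1)]"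
    and x2: "\<And>u. u \<in> ?D \<Longrightarrow> partial ?D S 2 u = vector [a, b, c + ?m * u $ 2 + c1 * u $ 1]"
    by blast+
  have "C1_surface_on ?D (partial ?D S 1) \<and>
    (\<forall>u\<in>?D. partial ?D (partial ?D S 1) 1 u = vector [0, 0, z'' (u $ 1)] \<and>
      partial ?D (partial ?D S 1) 2 u = vector [0, 0, c1])"
    by (rule C1_surface_on_strip[where F = "\<lambda>s t. vector [1, 0, c1 * t + z' s]", OF I x1];
        (intro has_vector_derivative_vector_3 continuous_on_vector_3 continuous_intros cont_z)?)
      (auto intro!: derivative_eq_intros z'')
  then have second1: "C1_surface_on ?D (partial ?D S 1)"
    and x11: "\<And>u. u \<in> ?D \<Longrightarrow> partial ?D (partial ?D S 1) 1 u = vector [0, 0, z'' (u $ 1)]"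
    and x12: "\<And>u. u \<in> ?D \<Longrightarrow> partial ?D (partial ?D S 1) 2 u = vector [0, 0, c1]"
    by blast+
  have "C1_surface_on ?D (partial ?D S 2) \<and>
    (\<forall>u\<in>?D. partial ?D (partial ?D S 2) 1 u = vector [0, 0, c1] \<and>
      partial ?D (partial ?D S 2) 2 u = vector [0, 0, ?m])"
    by (rule C1_surface_on_strip[where F = "\<lambda>s t. vector [a, b, c + ?m * t + c1 * s]", OF I x2];
        (intro has_vector_derivative_vector_3 continuous_on_vector_3 continuous_intros)?)
      (auto intro!: derivative_eq_intros)
  then have second2: "C1_surface_on ?D (partial ?D S 2)"
    and x22: "\<And>u. u \<in> ?D \<Longrightarrow> partial ?D (partial ?D S 2) 2 u = vector [0, 0, ?m]"
    by blast+
  have X12: "Xminor ?D S 1 2 u = b" if "u \<in> ?D" for u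
    using that by (simp add: Xminor_def x1 x2)
  show "admissible_on ?D S"
    using first second1 second2 X12 b
    by (auto simp: admissible_on_def C2_surface_on_def forall_2)
  fix u assume u: "u \<in> ?D"
  have metric: "first_form ?D S 1 1 u * first_form ?D S 2 2 u - (first_form ?D S 1 2 u)\<^sup>2 = b\<^sup>2"
    using u by (simp add: first_form_def iso_inner_def x1 x2 power2_eq_square)
  have inner: "v \<bullet> vector [0, 0, y] = v $ 3 * y" for v :: "real ^ 3" and y
    by (simp add: inner_vec_def sum_3)
  have h: "second_form ?D S 1 1 u = z'' (u $ 1)" "second_form ?D S 1 2 u = c1"
    "second_form ?D S 2 2 u = ?m"
    using u by (simp_all add: second_form_def x11 x12 x22 inner normal_h_def)
  show "gauss_curvature ?D S u = (?m * z'' (u $ 1) - c1\<^sup>2) / b\<^sup>2"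
    unfolding gauss_curvature_def metric h by (simp add: mult.commute)
qed

lemma graph_generating_curve:
  assumes I: "is_interval I" "\<And>x. I \<noteq> {x}"
    and z': "\<And>s. s \<in> I \<Longrightarrow> (z has_real_derivative z' s) (at s within I)"
    and z'': "\<And>s. s \<in> I \<Longrightarrow> (z' has_real_derivative z'' s) (at s within I)"
    and cont: "continuous_on I z''"
  shows "C2_curve_on I (generating_curve (\<lambda>s. s) z)"
    and "arc_length_param_on I (generating_curve (\<lambda>s. s) z)"
proof -
  let ?\<alpha> = "generating_curve (\<lambda>s. s) z"
  have deriv: "curve_deriv I f s = d" if "(f has_vector_derivative d) (at s within I)" "s \<in> I"
    for f s d
    unfolding curve_deriv_def
    by (rule vector_derivative_within[OF interval_at_within_neq_bot[OF I that(2)] that(1)])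
  have 1: "(?\<alpha> has_vector_derivative vector [1, 0, z' s]) (at s within I)" if "s \<in> I" for s
    unfolding generating_curve_def using that
    by (intro has_vector_derivative_vector_3 z') (auto intro!: derivative_eq_intros)
  have eq1: "curve_deriv I ?\<alpha> s = vector [1, 0, z' s]" if "s \<in> I" for s
    using deriv[OF 1] that by blast
  have 2: "(curve_deriv I ?\<alpha> has_vector_derivative vector [0, 0, z'' s]) (at s within I)"
    if "s \<in> I" for s
    by (rule has_vector_derivative_transform[OF that eq1],
        assumption, intro has_vector_derivative_vector_3 z'' that) auto
  have "curve_deriv I (curve_deriv I ?\<alpha>) s = vector [0, 0, z'' s]" if "s \<in> I" for s
    using deriv[OF 2] that by blast
  then have "continuous_on I (curve_deriv I (curve_deriv I ?\<alpha>))"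
    using continuous_on_vector_3[of I "\<lambda>_. 0" "\<lambda>_. 0", OF _ _ cont]
    by (simp cong: continuous_on_cong)
  with 1 2 show "C2_curve_on I ?\<alpha>"
    unfolding C2_curve_on_def differentiable_on_def by (blast intro: differentiableI_vector)
  show "arc_length_param_on I ?\<alpha>"
    by (simp add: arc_length_param_on_def iso_inner_def eq1)
qed

section \<open>The profile with prescribed curvature\<close>

theorem theorem5p6:
  fixes a b c c1 c2 s0 :: real and I :: "real set" and K :: "real \<Rightarrow> real"
  assumes "a * c1 + b * c2 \<noteq> 0" and "b \<noteq> 0"
    and "is_interval I" and "s0 \<in> I" and "I \<noteq> {s0}"
    and "continuous_on I K"
  shows "\<exists>z :: real \<Rightarrow> real \<Rightarrow> real \<Rightarrow> real.
    (\<forall>k0 k1.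
       (\<forall>s\<in>I. z k0 k1 s =
          k0 + k1 * s + c1\<^sup>2 * s\<^sup>2 / (2 * (a * c1 + b * c2))
          + b\<^sup>2 / (a * c1 + b * c2) * (LBINT v=s0..s. (LBINT w=s0..v. K w))) \<and>
       C2_curve_on I (generating_curve (\<lambda>s. s) (z k0 k1)) \<and>
       arc_length_param_on I (generating_curve (\<lambda>s. s) (z k0 k1)) \<and>
       admissible_on (param_strip I)
         (parabolic_revolution_surface a b c c1 c2 (\<lambda>s. s) (z k0 k1)) \<and>
       (\<forall>s\<in>I. \<forall>t.
          gauss_curvature (param_strip I)
            (parabolic_revolution_surface a b c c1 c2 (\<lambda>s. s) (z k0 k1)) (vector [s, t]) = K s)) \<and>
    bij (\<lambda>(k0, k1). (z k0 k1 s0, vector_derivative (z k0 k1) (at s0 within I)))"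
proof -
  define m where "m = a * c1 + b * c2"
  define z where "z k0 k1 s = k0 + k1 * s + c1\<^sup>2 * s\<^sup>2 / (2 * m)
    + b\<^sup>2 / m * (LBINT v=s0..s. (LBINT w=s0..v. K w))" for k0 k1 s :: real
  define z' where "z' k1 s = k1 + c1\<^sup>2 * s / m + b\<^sup>2 / m * (LBINT w=s0..s. K w)" for k1 s :: real
  define z'' where "z'' s = c1\<^sup>2 / m + b\<^sup>2 / m * K s" for s
  have m: "m \<noteq> 0"
    using assms(1) by (simp add: m_def)
  have I: "is_interval I" "\<And>x. I \<noteq> {x}"
    using assms(3-5) by auto
  have dK: "((\<lambda>s. LBINT w=s0..s. K w) has_real_derivative K s) (at s within I)" if "s \<in> I" for s
    unfolding has_real_derivative_iff_has_vector_derivative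
    by (rule interval_integral_has_vector_derivative_within) (use assms that in auto)
  then have "continuous_on I (\<lambda>s. LBINT w=s0..s. K w)"
    by (rule DERIV_continuous_on)
  then have dJ: "((\<lambda>s. LBINT v=s0..s. (LBINT w=s0..v. K w))
      has_real_derivative (LBINT w=s0..s. K w)) (at s within I)" if "s \<in> I" for s
    unfolding has_real_derivative_iff_has_vector_derivative
    by (intro interval_integral_has_vector_derivative_within) (use assms that in auto)
  have dz: "(z k0 k1 has_real_derivative z' k1 s) (at s within I)" if "s \<in> I" for k0 k1 s
    unfolding z_def z'_def using m
    by (auto intro!: derivative_eq_intros dJ[OF that] simp: field_simps)
  have dz': "(z' k1 has_real_derivative z'' s) (at s within I)" if "s \<in> I" for k1 s
    unfolding z'_def z''_def using m
    by (auto intro!: derivative_eq_intros dK[OF that] simp: field_simps)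
  have cont: "continuous_on I z''"
    unfolding z''_def by (intro continuous_intros assms m)
  have curvature: "(m * z'' s - c1\<^sup>2) / b\<^sup>2 = K s" for s
    using m assms(2) by (simp add: z''_def field_simps)
  have "vector_derivative (z k0 k1) (at s0 within I) = z' k1 s0" for k0 k1
    using dz[OF assms(4)] interval_at_within_neq_bot[OF I assms(4)]
    by (intro vector_derivative_within) (auto simp: has_real_derivative_iff_has_vector_derivative)
  then have "(\<lambda>(k0, k1). (z k0 k1 s0, vector_derivative (z k0 k1) (at s0 within I))) =
      (\<lambda>(k0, k1). (k0 + k1 * s0 + c1\<^sup>2 * s0\<^sup>2 / (2 * m), k1 + c1\<^sup>2 * s0 / m))"
    by (simp add: z_def z'_def fun_eq_iff)
  moreover have "bij (\<lambda>(k0, k1). (k0 + k1 * s0 + c1\<^sup>2 * s0\<^sup>2 / (2 * m), k1 + c1\<^sup>2 * s0 / m))"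
    by (rule bij_betw_byWitness[where f' = "\<lambda>(y, y'). (y - (y' - c1\<^sup>2 * s0 / m) * s0
          - c1\<^sup>2 * s0\<^sup>2 / (2 * m), y' - c1\<^sup>2 * s0 / m)"]) auto
  ultimately have "bij (\<lambda>(k0, k1). (z k0 k1 s0, vector_derivative (z k0 k1) (at s0 within I)))"
    by simp
  moreover have "\<forall>s\<in>I. z k0 k1 s = k0 + k1 * s + c1\<^sup>2 * s\<^sup>2 / (2 * (a * c1 + b * c2))
      + b\<^sup>2 / (a * c1 + b * c2) * (LBINT v=s0..s. (LBINT w=s0..v. K w))" for k0 k1
    by (simp add: z_def m_def)
  moreover have "\<forall>s\<in>I. \<forall>t. gauss_curvature (param_strip I)
      (parabolic_revolution_surface a b c c1 c2 (\<lambda>s. s) (z k0 k1)) (vector [s, t]) = K s" for k0 k1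
    using gauss_curvature_parabolic_revolution(2)[OF I assms(2) dz dz' cont] curvature[unfolded m_def]
    by (simp add: param_strip_def)
  ultimately show ?thesis
    using graph_generating_curve[OF I dz dz' cont]
      gauss_curvature_parabolic_revolution(1)[OF I assms(2) dz dz' cont]
    by (intro exI[of _ z]) simp
qed

end
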